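(* Fix $d\ge1$ and $c\ge1$. For every integer $k\ge1$, the intersection graph of any $n$ objects in $\mathbb{R}^d$ forming a $c$-fat collection admits a $\left(\frac{11}{9}3^k-\frac{2}{3}\right)$-hop spanner of size $O(n\,\alpha_k(n))$, where the constant in $O(\cdot)$ depends only on $d$, $k$ and $c$.
   Context: Objects are bounded subsets of $\mathbb{R}^d$. The side length of an object is the side length of its smallest enclosing axis-aligned hypercube. A collection of objects is $c$-fat if for every axis-aligned hypercube $\gamma$ with side length $\ell$, there exist $c$ points that together hit all objects of the collection that intersect $\gamma$ and have side length at least $\ell$. The intersection graph has the objects as vertices, with an edge iff the two objects intersect. For a graph $G$ and integer $t\ge1$, a $t$-hop spanner is a subgraph $\widehat{G}$ of $G$ on the same vertex set such that for every edge $uv\in E(G)$ there is a $u$–$v$ path in $\widehat{G}$ with at most $t$ edges; its size is its number of edges. The functions $\alpha_k$ form the inverse Ackermann hierarchy: $\alpha_0(n)=n/2$, and for $k\ge1$, $\alpha_k(n)$ is the number of times $\alpha_{k-1}$ must be iteratively applied starting from $n$ to reach a value at most $1$ (so $\alpha_1(n)=\Theta(\log n)$, $\alpha_2(n)=\Theta(\log^*n)$). *)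

theory Defs
  imports "HOL-Analysis.Analysis"
begin

fun inv_ack :: "nat \<Rightarrow> real \<Rightarrow> real" where
  "inv_ack 0 x = x / 2"
| "inv_ack (Suc k) x = real (LEAST i. ((inv_ack k) ^^ i) x \<le> 1)"

text \<open>Side length of the smallest enclosing axis-aligned hypercube.\<close>
definition side_len :: "(real ^ 'd) set \<Rightarrow> real" where
  "side_len S = Max ((\<lambda>i. (SUP x\<in>S. x $ i) - (INF x\<in>S. x $ i)) ` UNIV)"

definition hcube :: "real ^ 'd \<Rightarrow> real \<Rightarrow> (real ^ 'd) set" where
  "hcube a l = {x. \<forall>i. a $ i \<le> x $ i \<and> x $ i \<le> a $ i + l}"

definition c_fat :: "nat \<Rightarrow> nat \<Rightarrow> (nat \<Rightarrow> (real ^ 'd) set) \<Rightarrow> bool" where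
  "c_fat c n Obj \<longleftrightarrow>
     (\<forall>a l. l \<ge> 0 \<longrightarrow>
        (\<exists>P. finite P \<and> card P \<le> c \<and>
             (\<forall>i<n. Obj i \<inter> hcube a l \<noteq> {} \<and> side_len (Obj i) \<ge> l \<longrightarrow> P \<inter> Obj i \<noteq> {})))"

definition isect_edges :: "nat \<Rightarrow> (nat \<Rightarrow> (real ^ 'd) set) \<Rightarrow> nat set set" where
  "isect_edges n Obj = {{i, j} | i j. i < n \<and> j < n \<and> i \<noteq> j \<and> Obj i \<inter> Obj j \<noteq> {}}"

definition hop_path :: "nat set set \<Rightarrow> real \<Rightarrow> nat \<Rightarrow> nat \<Rightarrow> bool" where
  "hop_path H t u v \<longleftrightarrow>
     (\<exists>p. p \<noteq> [] \<and> hd p = u \<and> last p = v \<and>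
          (\<forall>m. Suc m < length p \<longrightarrow> {p ! m, p ! Suc m} \<in> H) \<and>
          real (length p - 1) \<le> t)"

definition hop_spanner :: "nat \<Rightarrow> (nat \<Rightarrow> (real ^ 'd) set) \<Rightarrow> nat set set \<Rightarrow> real \<Rightarrow> bool" where
  "hop_spanner n Obj H t \<longleftrightarrow>
     H \<subseteq> isect_edges n Obj \<and>
     (\<forall>u v. {u, v} \<in> isect_edges n Obj \<longrightarrow> hop_path H t u v)"

end

theory Submission
  imports Defs
begin

text \<open>
  Cut every object into its intersections with the cells of a dyadic grid whose cell side is
  comparable to the side length of the object; this gives at most \<open>3\<^sup>d\<close> pieces per object, and the
  cells are laminar, so the pieces form a forest. If \<open>u\<close> and \<open>v\<close> meet in a point \<open>x\<close>, their pieces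
  at \<open>x\<close> are comparable, say \<open>a\<close> below \<open>b\<close>, and \<open>v\<close> is hit by one of the \<open>c\<close> points that fatness
  provides for any cell between \<open>a\<close> and \<open>b\<close>. A forest with \<open>N\<close> nodes has a set of
  \<open>O(N \<alpha>\<^sub>k(N))\<close> shortcuts that joins any comparable pair by a monotone path
  \<open>a = y\<^sub>0, y\<^sub>1, \<dots>, y\<^sub>h = b\<close> with \<open>h = 2 k\<close>. Fix a centre among the objects through each point. Along
  this path, go from \<open>u\<close> to a neighbour of \<open>u\<close> through a point of \<open>y\<^sub>1\<close> that lies in \<open>v\<close>, then to the
  centre of that point, then from centre to centre with two hops per shortcut, via an object
  containing both points (\<open>v\<close> is one), and finally from the centre at \<open>y\<close> with index \<open>h - 1\<close> to \<open>v\<close>.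
  These are \<open>2 h - 1 = 4 k - 1\<close> hops, which is at most \<open>(11/9) 3\<^sup>k - 2/3\<close>.
\<close>

section \<open>The inverse Ackermann hierarchy on natural numbers\<close>

text \<open>The index is shifted: \<open>ack_inv k\<close> is \<open>\<alpha>\<close> at level \<open>k + 1\<close>.\<close>


definition ack_inv :: "nat \<Rightarrow> nat \<Rightarrow> nat" where
  "ack_inv k n = (LEAST i. (inv_ack k ^^ i) (real n) \<le> 1)"

lemma inv_ack_Suc_of_nat: "inv_ack (Suc k) (real n) = real (ack_inv k n)"
  by (simp add: ack_inv_def)

lemma inv_ack_0_funpow: "(inv_ack 0 ^^ i) x = x / 2 ^ i"
  by (induction i) auto

text \<open>Iterated halving makes level 0 the binary logarithm rounded up (and 0 at
  \<open>n = 0\<close>); this equivalence stands in for its \<open>LEAST\<close>.\<close>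

lemma ack_inv_0_le_iff: "ack_inv 0 n \<le> i \<longleftrightarrow> n \<le> 2 ^ i"
proof -
  have Q: "(inv_ack 0 ^^ i) (real n) \<le> 1 \<longleftrightarrow> n \<le> 2 ^ i" for i
  proof -
    have "real n / 2 ^ i \<le> 1 \<longleftrightarrow> real n \<le> real (2 ^ i)"
      by (simp add: divide_le_eq)
    then show ?thesis
      by (simp only: inv_ack_0_funpow of_nat_le_iff)
  qed
  have eq: "ack_inv 0 n = (LEAST i. n \<le> 2 ^ i)"
    unfolding ack_inv_def Q ..
  have "n \<le> 2 ^ n" by simp
  then have "n \<le> 2 ^ ack_inv 0 n"
    unfolding eq by (rule LeastI)
  then show ?thesis
    unfolding eq
    by (metis Least_le le_trans one_le_numeral power_increasing)
qed

text \<open>\<open>inv_ack (Suc k)\<close> maps naturals to naturals, so the iteration that defines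
  the next level can be run without reals.\<close>

lemma ack_inv_Suc: "ack_inv (Suc k) n = (LEAST i. (ack_inv k ^^ i) n \<le> 1)"
proof -
  have "(inv_ack (Suc k) ^^ i) (real n) = real ((ack_inv k ^^ i) n)" for i
    by (induction i) (simp_all add: inv_ack_Suc_of_nat del: inv_ack.simps)
  then show ?thesis
    by (simp add: ack_inv_def del: inv_ack.simps)
qed

section \<open>Recursion, decrease and growth of the levels\<close>

lemma ack_inv_le_1: "n \<le> 1 \<Longrightarrow> ack_inv k n = 0"
  unfolding ack_inv_def by (rule Least_eq_0) simp

text \<open>Strict decrease makes the iteration reach 1, so the \<open>LEAST\<close> is attained.
  The decrease at level \<open>k\<close> is a hypothesis because its proof for level
  \<open>Suc k\<close> uses this very recursion.\<close>

lemma ack_inv_Suc_rec_aux: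
  assumes less: "\<And>m. m \<ge> 2 \<Longrightarrow> ack_inv k m < m" and "n \<ge> 2"
  shows "ack_inv (Suc k) n = Suc (ack_inv (Suc k) (ack_inv k n))"
proof -
  have "\<exists>i. (ack_inv k ^^ i) m \<le> 1" for m
  proof (induction m rule: less_induct)
    case (less m)
    show ?case
    proof (cases "m \<le> 1")
      case True
      then show ?thesis by (intro exI[of _ 0]) simp
    next
      case False
      then obtain i where "(ack_inv k ^^ i) (ack_inv k m) \<le> 1"
        using less assms(1)[of m] by force
      then have "(ack_inv k ^^ Suc i) m \<le> 1"
        by (simp only: funpow_Suc_right o_apply)
      then show ?thesis by blast
    qed
  qed
  then obtain i where i: "(ack_inv k ^^ i) n \<le> 1" by blast
  have "(LEAST i. (ack_inv k ^^ i) n \<le> 1) = Suc (LEAST i. (ack_inv k ^^ Suc i) n \<le> 1)"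
    by (rule Least_Suc[where P = "\<lambda>i. (ack_inv k ^^ i) n \<le> 1", OF i]) (use \<open>n \<ge> 2\<close> in simp)
  then show ?thesis
    unfolding ack_inv_Suc by (simp only: funpow_Suc_right o_apply)
qed

text \<open>The first application leads to \<open>ack_inv k n < n\<close>, and the inner induction
  on \<open>n\<close> puts the remaining count below that value.\<close>

lemma ack_inv_less: "n \<ge> 1 \<Longrightarrow> ack_inv k n < n"
proof (induction k arbitrary: n)
  case 0
  have "n \<le> 2 ^ (n - 1)"
    using 0 by (metis Suc_pred' less_exp less_eq_Suc_le One_nat_def)
  then have "ack_inv 0 n \<le> n - 1"
    by (simp only: ack_inv_0_le_iff)
  with 0 show ?case by simp
next
  case (Suc k)
  show ?case
    using Suc.prems
  proof (induction n rule: less_induct)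
    case (less n)
    show ?case
    proof (cases "n \<ge> 2")
      case True
      have eq: "ack_inv (Suc k) n = Suc (ack_inv (Suc k) (ack_inv k n))"
        by (rule ack_inv_Suc_rec_aux) (use Suc.IH True in auto)
      have "ack_inv k n < n"
        using Suc.IH True by simp
      then show ?thesis
        using eq less.IH[of "ack_inv k n"] True ack_inv_le_1[of "ack_inv k n" "Suc k"]
        by (cases "ack_inv k n \<ge> 1") auto
    qed (use less.prems ack_inv_le_1[of n] in simp)
  qed
qed

lemma ack_inv_Suc_rec:
  "n \<ge> 2 \<Longrightarrow> ack_inv (Suc k) n = Suc (ack_inv (Suc k) (ack_inv k n))"
  by (rule ack_inv_Suc_rec_aux) (auto intro: ack_inv_less)

lemma ack_inv_pos: "n \<ge> 2 \<Longrightarrow> ack_inv k n \<ge> 1"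
  using ack_inv_0_le_iff[of n 0] ack_inv_Suc_rec[of n] by (cases k) auto

lemma ack_inv_mono: "m \<le> n \<Longrightarrow> ack_inv k m \<le> ack_inv k n"
proof (induction k arbitrary: m n)
  case 0
  then show ?case
    using ack_inv_0_le_iff le_trans by blast
next
  case (Suc k)
  show ?case
    using Suc.prems
  proof (induction n arbitrary: m rule: less_induct)
    case (less n)
    show ?case
    proof (cases "m \<ge> 2")
      case True
      then show ?thesis
        using less Suc.IH[of m n] ack_inv_less[of n k] by (simp add: ack_inv_Suc_rec)
    qed (simp add: ack_inv_le_1)
  qed
qed

text \<open>Since \<open>a + 1 \<le> 2 * a\<close> for \<open>a \<ge> 1\<close>, one application at
  the lower level again leaves arguments within a factor of two, and induction on \<open>n\<close>
  applies.\<close>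

lemma ack_inv_double: "ack_inv k (2 * n) \<le> Suc (ack_inv k n)"
proof (induction k arbitrary: n)
  case 0
  have "n \<le> 2 ^ ack_inv 0 n"
    using ack_inv_0_le_iff by blast
  then show ?case
    by (simp add: ack_inv_0_le_iff)
next
  case (Suc k)
  show ?case
  proof (induction n rule: less_induct)
    case (less n)
    consider "n = 0" | "n = 1" | "n \<ge> 2" by linarith
    then show ?case
    proof cases
      case 2
      then show ?thesis
        using ack_inv_less[of 2 "Suc k"] by simp
    next
      case 3
      have "ack_inv k (2 * n) \<le> 2 * ack_inv k n"
        using Suc.IH[of n] ack_inv_pos[OF 3, of k] by linarith
      then have "ack_inv (Suc k) (ack_inv k (2 * n)) \<le> ack_inv (Suc k) (2 * ack_inv k n)"
        by (rule ack_inv_mono)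
      also have "\<dots> \<le> Suc (ack_inv (Suc k) (ack_inv k n))"
        using less ack_inv_less[of n k] 3 by simp
      finally show ?thesis
        using 3 by (simp add: ack_inv_Suc_rec)
    qed (simp add: ack_inv_le_1)
  qed
qed

text \<open>Turns the constant factor between pieces and objects into an additive constant.\<close>

lemma ack_inv_pow2_mult: "ack_inv k (2 ^ e * n) \<le> ack_inv k n + e"
proof (induction e)
  case (Suc e)
  then show ?case
    using ack_inv_double[of k "2 ^ e * n"] by (simp add: mult.assoc)
qed simp

section \<open>Shortcuts in forests\<close>

text \<open>\<open>R\<close> is abstract because the result serves for the top of a chain and, with
  the order reversed, for its bottom.\<close>

lemma finite_total_greatest:
  assumes "finite S" "S \<noteq> {}"
    and "\<And>x y. x \<in> S \<Longrightarrow> y \<in> S \<Longrightarrow> R x y \<or> R y x"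
    and trans: "\<And>x y z. R x y \<Longrightarrow> R y z \<Longrightarrow> R x z"
  shows "\<exists>m\<in>S. \<forall>s\<in>S. R s m"
  using assms(1-3)
proof (induction S rule: finite_ne_induct)
  case (insert x F)
  then obtain m where m: "m \<in> F" "\<forall>s\<in>F. R s m" by (metis insertCI)
  with insert.prems show ?case
    by (metis insert_iff trans)
qed blast

lemma relpow_reflcl_mono: "E \<subseteq> E' \<Longrightarrow> (E\<^sup>=) ^^ h \<subseteq> (E'\<^sup>=) ^^ h"
proof (induction h)
  case (Suc h)
  then show ?case
    by (auto simp: relpow.simps intro!: relcomp_mono)
qed simp

text \<open>Roots are at the top: \<open>chain\<close> orders the elements above a given one
  linearly. Only \<open>chain\<close> is restricted to \<open>U\<close>; for pieces it needs genuine
  cells, while the order laws hold for all pairs.\<close>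

locale forest_order =
  fixes le :: "'a \<Rightarrow> 'a \<Rightarrow> bool" (infix "\<sqsubseteq>" 50) and U :: "'a set"
  assumes refl: "a \<sqsubseteq> a"
    and trans: "a \<sqsubseteq> b \<Longrightarrow> b \<sqsubseteq> c \<Longrightarrow> a \<sqsubseteq> c"
    and antisym: "a \<sqsubseteq> b \<Longrightarrow> b \<sqsubseteq> a \<Longrightarrow> a = b"
    and chain: "a \<in> U \<Longrightarrow> b \<in> U \<Longrightarrow> c \<in> U \<Longrightarrow> a \<sqsubseteq> b \<Longrightarrow> a \<sqsubseteq> c \<Longrightarrow> b \<sqsubseteq> c \<or> c \<sqsubseteq> b"
begin

text \<open>The part of the subtree of \<open>r\<close> that stays connected to \<open>r\<close>
  when \<open>X\<close> is removed; it is empty for \<open>r\<close> in \<open>X\<close>.\<close>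

definition below_free :: "'a set \<Rightarrow> 'a set \<Rightarrow> 'a \<Rightarrow> 'a set" where
  "below_free A X r = {a \<in> A. a \<sqsubseteq> r \<and> \<not> (\<exists>x\<in>X. a \<sqsubseteq> x \<and> x \<sqsubseteq> r)}"

text \<open>Greedy choice: a lowest node with more than \<open>g\<close> nodes under it joins
  \<open>X\<close> and its subtree is discarded. Each chosen node is paid for by at least
  \<open>Suc g\<close> discarded ones.\<close>

lemma cut_set_exists:
  assumes "finite A" "A \<subseteq> U"
  shows "\<exists>X\<subseteq>A. card X * Suc g \<le> card A \<and> (\<forall>r\<in>A. card (below_free A X r) \<le> g)"
  using assms
proof (induction A rule: finite_psubset_induct)
  case (psubset A)
  define down where "down x = {a \<in> A. a \<sqsubseteq> x}" for x
  have fin: "finite (down x)" for x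
    using psubset.hyps by (simp add: down_def)
  have sub: "below_free A X r \<subseteq> down r" for X r
    by (auto simp: below_free_def down_def)
  show ?case
  proof (cases "\<exists>x\<in>A. card (down x) > g")
    case False
    have "card (below_free A {} r) \<le> g" if "r \<in> A" for r
      using False that card_mono[OF fin sub, of "{}" r] by fastforce
    then show ?thesis
      by (intro exI[of _ "{}"]) simp
  next
    case True
    \<comment> \<open>Minimality of the subtree size leaves at most \<open>g\<close> nodes under
      every node strictly below \<open>x\<close>.\<close>
    then obtain x where x: "x \<in> A" "card (down x) > g"
      and min: "\<And>y. y \<in> A \<Longrightarrow> card (down y) > g \<Longrightarrow> card (down x) \<le> card (down y)"
      using ex_has_least_nat[of "\<lambda>x. x \<in> A \<and> card (down x) > g" _ "\<lambda>x. card (down x)"]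
      by metis
    define A' where "A' = A - down x"
    have "x \<in> down x"
      using x refl by (simp add: down_def)
    then have "A' \<subset> A"
      using x by (auto simp: A'_def)
    then obtain X where X: "X \<subseteq> A'" "card X * Suc g \<le> card A'"
      "\<And>r. r \<in> A' \<Longrightarrow> card (below_free A' X r) \<le> g"
      using psubset.IH[of A'] psubset.prems by blast
    have "finite A'" "finite X" "x \<notin> X"
      using X \<open>A' \<subset> A\<close> psubset.hyps \<open>x \<in> down x\<close> by (auto simp: A'_def intro: finite_subset)
    have "down x \<subseteq> A"
      by (auto simp: down_def)
    then have "card A = card A' + card (down x)"
      unfolding A'_def using card_Diff_subset[OF fin] card_mono[OF psubset.hyps] by simp
    then have "card (insert x X) * Suc g \<le> card A"
      using X x \<open>finite X\<close> \<open>x \<notin> X\<close> by simp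
    moreover have "card (below_free A (insert x X) r) \<le> g" if "r \<in> A" for r
    proof (cases "r \<in> A'")
      case True
      then have "\<not> r \<sqsubseteq> x"
        using that by (simp add: A'_def down_def)
      \<comment> \<open>Discarded nodes below \<open>r\<close> do not count: they lie under both
        \<open>x\<close> and \<open>r\<close>, so \<open>chain\<close> puts \<open>x\<close> below
        \<open>r\<close>, and \<open>x\<close> separates them from \<open>r\<close>.\<close>
      then have "below_free A (insert x X) r \<subseteq> below_free A' X r"
        using chain[of _ x r] x psubset.prems that by (auto simp: below_free_def A'_def down_def)
      moreover have "finite (below_free A' X r)"
        using \<open>finite A'\<close> by (simp add: below_free_def)
      ultimately show ?thesis
        using X(3)[OF True] card_mono le_trans by meson
    next
      case False
      then have "r \<sqsubseteq> x"
        using that by (simp add: A'_def down_def)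
      show ?thesis
      proof (cases "r = x")
        case True
        then have "below_free A (insert x X) r = {}"
          using refl by (auto simp: below_free_def)
        then show ?thesis by simp
      next
        case False
        have "down r \<subseteq> down x"
          using \<open>r \<sqsubseteq> x\<close> by (auto simp: down_def intro: trans)
        moreover have "x \<notin> down r"
          using antisym[of r x] False \<open>r \<sqsubseteq> x\<close> by (auto simp: down_def)
        ultimately have "card (down r) < card (down x)"
          using \<open>x \<in> down x\<close> by (intro psubset_card_mono[OF fin]) blast
        then have "card (down r) \<le> g"
          using min[OF that] by (meson not_le)
        then show ?thesis
          using card_mono[OF fin sub] le_trans by meson
      qed
    qed
    ultimately show ?thesis
      using X(1) x \<open>A' \<subset> A\<close> by (intro exI[of _ "insert x X"]) auto
  qed
qed

text \<open>The reflexive closure turns "exactly \<open>h\<close> steps" into "at most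
  \<open>h\<close> shortcuts". All shortcuts point upward, so every such walk is monotone.\<close>

definition shortcut_set :: "'a set \<Rightarrow> nat \<Rightarrow> ('a \<times> 'a) set \<Rightarrow> bool" where
  "shortcut_set A h E \<longleftrightarrow>
     E \<subseteq> {(a, b) \<in> A \<times> A. a \<sqsubseteq> b} \<and> (\<forall>a\<in>A. \<forall>b\<in>A. a \<sqsubseteq> b \<longrightarrow> (a, b) \<in> (E\<^sup>=) ^^ h)"

section \<open>Building blocks of shortcut sets: components and links\<close>

lemma shortcut_set_small:
  assumes "finite A" "card A \<le> 1"
  shows "shortcut_set A h {}"
proof -
  have "(a, a) \<in> (({} :: ('a \<times> 'a) set)\<^sup>=) ^^ h" for a
    by (induction h) auto
  then show ?thesis
    using assms by (auto simp: shortcut_set_def card_le_Suc0_iff_eq)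
qed

text \<open>The nodes above \<open>a\<close> that \<open>X\<close> does not separate from
  \<open>a\<close> form a chain, and \<open>root a\<close> is its top. By the last clause the fibres
  of \<open>root\<close> are components: an unseparated comparable pair never straddles two of
  them.\<close>

lemma component_roots:
  assumes "finite A" "A \<subseteq> U" "X \<subseteq> A"
  shows "\<exists>root. \<forall>a\<in>A - X. a \<in> below_free A X (root a) \<and> root a \<in> A \<and>
           (\<forall>b\<in>A. a \<in> below_free A X b \<longrightarrow> root b = root a)"
proof -
  define Q where "Q a = {b \<in> A. a \<in> below_free A X b}" for a
  have "\<exists>m\<in>Q a. \<forall>s\<in>Q a. s \<sqsubseteq> m" if "a \<in> A - X" for a
  proof (rule finite_total_greatest)
    show "finite (Q a)" using assms by (simp add: Q_def)
    have "a \<in> Q a"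
      using that refl antisym by (auto simp: Q_def below_free_def)
    then show "Q a \<noteq> {}" by blast
    show "x \<sqsubseteq> y \<or> y \<sqsubseteq> x" if "x \<in> Q a" "y \<in> Q a" for x y
      using chain[of a x y] that assms by (auto simp: Q_def below_free_def)
  qed (rule trans)
  then obtain root where root: "\<And>a. a \<in> A - X \<Longrightarrow> root a \<in> Q a"
    "\<And>a s. a \<in> A - X \<Longrightarrow> s \<in> Q a \<Longrightarrow> s \<sqsubseteq> root a"
    by metis
  have "root b = root a" if ab: "a \<in> A - X" "b \<in> Q a" for a b
  proof (rule antisym)
    have b: "b \<in> A" "a \<sqsubseteq> b" and free: "\<And>x. x \<in> X \<Longrightarrow> a \<sqsubseteq> x \<Longrightarrow> \<not> x \<sqsubseteq> b"
      using ab by (auto simp: Q_def below_free_def)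
    then have "b \<in> A - X"
      using refl by blast
    have "Q b \<subseteq> Q a"
    proof
      fix b' assume "b' \<in> Q b"
      then have b': "b' \<in> A" "b \<sqsubseteq> b'" "\<And>x. x \<in> X \<Longrightarrow> b \<sqsubseteq> x \<Longrightarrow> \<not> x \<sqsubseteq> b'"
        by (auto simp: Q_def below_free_def)
      \<comment> \<open>Both \<open>x\<close> and \<open>b\<close> lie above \<open>a\<close>, so
        \<open>x\<close> would separate \<open>a\<close> from \<open>b\<close> or \<open>b\<close>
        from \<open>b'\<close>.\<close>
      have "\<not> x \<sqsubseteq> b'" if "x \<in> X" "a \<sqsubseteq> x" for x
        using chain[of a x b] free[of x] b'(3)[of x] that ab(1) b assms by blast
      then show "b' \<in> Q a"
        using trans[OF b(2) b'(2)] b' ab(1) by (auto simp: Q_def below_free_def)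
    qed
    then show "root b \<sqsubseteq> root a"
      using root \<open>b \<in> A - X\<close> ab by blast
    have "\<not> x \<sqsubseteq> root a" if "x \<in> X" "b \<sqsubseteq> x" for x
      using root(1)[OF ab(1)] that trans[OF b(2) that(2)] by (auto simp: Q_def below_free_def)
    then have "root a \<in> Q b"
      using root(1)[OF ab(1)] root(2)[OF ab] b by (auto simp: Q_def below_free_def)
    then show "root a \<sqsubseteq> root b"
      using root \<open>b \<in> A - X\<close> by blast
  qed
  then show ?thesis
    using root(1) by (intro exI[of _ root]) (auto simp: Q_def)
qed

text \<open>A node has at most one lowest element of \<open>X\<close> above it, so the source
  determines the link.\<close>

lemma card_up_links:
  assumes "finite A" "A \<subseteq> U" "X \<subseteq> A"
  shows "card {(a, x). a \<in> A \<and> x \<in> X \<and> a \<sqsubseteq> x \<and> (\<forall>x'\<in>X. a \<sqsubseteq> x' \<longrightarrow> x \<sqsubseteq> x')} \<le> card A"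
    (is "card ?E \<le> _")
proof (rule card_inj_on_le)
  show "inj_on fst ?E"
    using antisym by (auto simp: inj_on_def)
qed (use assms in auto)

text \<open>A target \<open>b\<close> can have many highest elements of \<open>X\<close> below it,
  so these links are charged to their source \<open>x\<close> instead.\<close>

lemma card_down_links:
  assumes "finite A" "A \<subseteq> U" "X \<subseteq> A" and g: "\<And>r. r \<in> A \<Longrightarrow> card (below_free A X r) \<le> g"
  shows "card {(x, b). x \<in> X \<and> b \<in> A - X \<and> x \<sqsubseteq> b \<and>
           (\<forall>x'\<in>X. x \<sqsubseteq> x' \<and> x' \<sqsubseteq> b \<longrightarrow> x' = x)} \<le> card X * g"
proof -
  define B where "B x = {b \<in> A - X. x \<sqsubseteq> b \<and> (\<forall>x'\<in>X. x \<sqsubseteq> x' \<and> x' \<sqsubseteq> b \<longrightarrow> x' = x)}" for x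
  have finX: "finite X" using assms finite_subset by blast
  have finB: "finite (B x)" for x using assms by (simp add: B_def)
  \<comment> \<open>\<open>B x\<close> is a chain inside a single component of \<open>A - X\<close>.\<close>
  have "card (B x) \<le> g" if "x \<in> X" for x
  proof (cases "B x = {}")
    case False
    have "\<exists>t\<in>B x. \<forall>b\<in>B x. b \<sqsubseteq> t"
    proof (rule finite_total_greatest[OF finB False])
      show "b \<sqsubseteq> b' \<or> b' \<sqsubseteq> b" if "b \<in> B x" "b' \<in> B x" for b b'
        using chain[of x b b'] that \<open>x \<in> X\<close> assms by (auto simp: B_def)
    qed (rule trans)
    then obtain t where t: "t \<in> B x" "\<And>b. b \<in> B x \<Longrightarrow> b \<sqsubseteq> t" by blast
    have "b \<in> below_free A X t" if "b \<in> B x" for b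
    proof -
      have b: "b \<in> A - X" "x \<sqsubseteq> b" using that by (auto simp: B_def)
      have "\<not> x' \<sqsubseteq> t" if "x' \<in> X" "b \<sqsubseteq> x'" for x'
      proof
        assume "x' \<sqsubseteq> t"
        then have "x' = x"
          using t(1) that trans[OF b(2) that(2)] by (auto simp: B_def)
        then show False
          using antisym[of b x] b that by blast
      qed
      then show ?thesis
        using b t(2)[OF that] by (auto simp: below_free_def)
    qed
    then have "B x \<subseteq> below_free A X t" by blast
    moreover have "finite (below_free A X t)"
      using assms by (simp add: below_free_def)
    moreover have "t \<in> A" using t by (simp add: B_def)
    ultimately show ?thesis
      using g card_mono le_trans by meson
  qed simp
  then have "(\<Sum>x\<in>X. card (B x)) \<le> card X * g"
    using sum_bounded_above[of X "\<lambda>x. card (B x)" g] by simp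
  moreover have "card (SIGMA x:X. B x) = (\<Sum>x\<in>X. card (B x))"
    using finX finB by simp
  moreover have "{(x, b). x \<in> X \<and> b \<in> A - X \<and> x \<sqsubseteq> b \<and>
      (\<forall>x'\<in>X. x \<sqsubseteq> x' \<and> x' \<sqsubseteq> b \<longrightarrow> x' = x)} = (SIGMA x:X. B x)"
    by (auto simp: B_def)
  ultimately show ?thesis by simp
qed

text \<open>
  The first and last elements of \<open>X\<close> on the way from \<open>a\<close> to \<open>b\<close> are joined by the shortcuts of \<open>X\<close>;
  if there are none, then \<open>a\<close> and \<open>b\<close> lie in the same component of \<open>A - X\<close>.
\<close>
lemma shortcut_set_step:
  assumes fin: "finite A" and AU: "A \<subseteq> U" and XA: "X \<subseteq> A"
    and g: "\<And>r. r \<in> A \<Longrightarrow> card (below_free A X r) \<le> g"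
    and EG: "shortcut_set X h EG"
    and small: "\<And>D. D \<subseteq> A \<Longrightarrow> card D \<le> g \<Longrightarrow>
        \<exists>E. shortcut_set D (h + 2) E \<and> card E \<le> K * card D"
  shows "\<exists>E. shortcut_set A (h + 2) E \<and> card E \<le> card EG + K * card A + card A + card X * g"
proof -
  obtain root where *: "\<forall>a\<in>A - X. a \<in> below_free A X (root a) \<and> root a \<in> A \<and>
      (\<forall>b\<in>A. a \<in> below_free A X b \<longrightarrow> root b = root a)"
    using component_roots[OF fin AU XA] by (rule exE)
  have root: "\<And>a. a \<in> A - X \<Longrightarrow> a \<in> below_free A X (root a)"
    "\<And>a. a \<in> A - X \<Longrightarrow> root a \<in> A"
    "\<And>a b. a \<in> A - X \<Longrightarrow> b \<in> A \<Longrightarrow> a \<in> below_free A X b \<Longrightarrow> root b = root a"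
    using * by simp_all
  define D where "D r = {a \<in> A - X. root a = r}" for r
  have "card (D r) \<le> g" for r
  proof (cases "D r = {}")
    case False
    then have "r \<in> A" using root(2) by (auto simp: D_def)
    moreover have "D r \<subseteq> below_free A X r"
      using root(1) by (auto simp: D_def)
    moreover have "finite (below_free A X r)"
      using fin by (simp add: below_free_def)
    ultimately show ?thesis
      using g card_mono le_trans by meson
  qed simp
  then have "\<exists>E. shortcut_set (D r) (h + 2) E \<and> card E \<le> K * card (D r)" for r
    by (intro small) (auto simp: D_def)
  then obtain F where F: "\<And>r. shortcut_set (D r) (h + 2) (F r)"
    "\<And>r. card (F r) \<le> K * card (D r)"
    by metis
  define E1 where "E1 = {(a, x). a \<in> A \<and> x \<in> X \<and> a \<sqsubseteq> x \<and> (\<forall>x'\<in>X. a \<sqsubseteq> x' \<longrightarrow> x \<sqsubseteq> x')}"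
  define E2 where "E2 = {(x, b). x \<in> X \<and> b \<in> A - X \<and> x \<sqsubseteq> b \<and>
           (\<forall>x'\<in>X. x \<sqsubseteq> x' \<and> x' \<sqsubseteq> b \<longrightarrow> x' = x)}"
  define R where "R = root ` (A - X)"
  \<comment> \<open>A path uses either a component's own shortcuts \<open>F r\<close>, or one link
    of \<open>E1\<close> into \<open>X\<close>, then \<open>EG\<close>, then one link of
    \<open>E2\<close> out of \<open>X\<close>; the two links account for the 2 in
    \<open>h + 2\<close>.\<close>
  define E where "E = EG \<union> (\<Union>r\<in>R. F r) \<union> E1 \<union> E2"
  have finR: "finite R" using fin by (simp add: R_def)
  have "card (\<Union>r\<in>R. F r) \<le> (\<Sum>r\<in>R. card (F r))"
    by (rule card_UN_le[OF finR])
  also have "\<dots> \<le> (\<Sum>r\<in>R. K * card (D r))"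
    by (rule sum_mono) (rule F(2))
  also have "\<dots> = K * card (A - X)"
  proof -
    \<comment> \<open>The fibres of \<open>root\<close> partition \<open>A - X\<close>.\<close>
    have "card (A - X) = (\<Sum>r\<in>R. card {a \<in> A - X. root a = r})"
      unfolding R_def card_eq_sum by (rule sum.image_gen) (use fin in simp)
    then show ?thesis
      by (simp add: D_def sum_distrib_left)
  qed
  also have "\<dots> \<le> K * card A"
    using fin by (intro mult_left_mono card_mono) auto
  finally have cF: "card (\<Union>r\<in>R. F r) \<le> K * card A" .
  have "card E \<le> card EG + card (\<Union>r\<in>R. F r) + card E1 + card E2"
    unfolding E_def using card_Un_le[of "EG \<union> (\<Union>r\<in>R. F r) \<union> E1" E2]
      card_Un_le[of "EG \<union> (\<Union>r\<in>R. F r)" E1] card_Un_le[of EG "\<Union>r\<in>R. F r"] by linarith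
  also have "\<dots> \<le> card EG + K * card A + card A + card X * g"
    using cF card_up_links[OF fin AU XA] card_down_links[OF fin AU XA g]
    unfolding E1_def[symmetric] E2_def[symmetric] by linarith
  finally have "card E \<le> card EG + K * card A + card A + card X * g" .
  moreover have "shortcut_set A (h + 2) E"
    unfolding shortcut_set_def
  proof (intro conjI ballI impI)
    have "F r \<subseteq> {(a, b) \<in> A \<times> A. a \<sqsubseteq> b}" for r
      using F(1)[of r] by (auto simp: shortcut_set_def D_def)
    then show "E \<subseteq> {(a, b) \<in> A \<times> A. a \<sqsubseteq> b}"
      using EG XA by (auto simp: E_def E1_def E2_def shortcut_set_def)
  next
    fix a b assume ab: "a \<in> A" "b \<in> A" "a \<sqsubseteq> b"
    show "(a, b) \<in> (E\<^sup>=) ^^ (h + 2)"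
    proof (cases "\<exists>x\<in>X. a \<sqsubseteq> x \<and> x \<sqsubseteq> b")
      case False
      then have "a \<in> below_free A X b" "a \<in> A - X" "b \<in> A - X"
        using ab refl by (auto simp: below_free_def)
      then have "a \<in> D (root a)" "b \<in> D (root a)" "root a \<in> R"
        using root(3)[of a b] by (auto simp: D_def R_def)
      then have "(a, b) \<in> ((F (root a))\<^sup>=) ^^ (h + 2)" "F (root a) \<subseteq> E"
        using F(1)[of "root a"] ab by (auto simp: shortcut_set_def E_def)
      then show ?thesis
        using relpow_reflcl_mono by blast
    next
      case True
      define I where "I = {x \<in> X. a \<sqsubseteq> x \<and> x \<sqsubseteq> b}"
      have I: "finite I" "I \<noteq> {}"
        using True finite_subset[OF XA fin] by (auto simp: I_def)
      have I_chain: "x \<sqsubseteq> y \<or> y \<sqsubseteq> x" if "x \<in> I" "y \<in> I" for x y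
        using chain[of a x y] that XA AU ab by (auto simp: I_def)
      obtain x1 where x1: "x1 \<in> I" "\<And>x. x \<in> I \<Longrightarrow> x1 \<sqsubseteq> x"
        using finite_total_greatest[OF I, of "\<lambda>x y. y \<sqsubseteq> x"] I_chain trans by blast
      obtain x2 where x2: "x2 \<in> I" "\<And>x. x \<in> I \<Longrightarrow> x \<sqsubseteq> x2"
        using finite_total_greatest[OF I, of "(\<sqsubseteq>)"] I_chain trans by blast
      \<comment> \<open>\<open>E1\<close> asks for the lowest element of \<open>X\<close> among all
        those above \<open>a\<close>, not only those below \<open>b\<close>; an element under
        \<open>x1\<close> would lie below \<open>b\<close> as well.\<close>
      have "x1 \<sqsubseteq> x'" if "x' \<in> X" "a \<sqsubseteq> x'" for x'
        using chain[of a x1 x'] that x1 ab AU XA trans[of x' x1 b] by (auto simp: I_def)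
      then have "(a, x1) \<in> E\<^sup>="
        using x1 ab by (auto simp: E_def E1_def I_def)
      moreover have "(x1, x2) \<in> (E\<^sup>=) ^^ h"
      proof -
        have "(x1, x2) \<in> (EG\<^sup>=) ^^ h"
          using EG x1 x2 by (auto simp: shortcut_set_def I_def)
        then show ?thesis
          using relpow_reflcl_mono[of EG E] by (auto simp: E_def)
      qed
      \<comment> \<open>Links in \<open>E2\<close> end outside \<open>X\<close>; a target in
        \<open>X\<close> is \<open>x2\<close> itself and needs no hop.\<close>
      moreover have "(x2, b) \<in> E\<^sup>="
      proof (cases "b \<in> X")
        case True
        then have "b = x2"
          using x2 ab refl antisym by (auto simp: I_def)
        then show ?thesis by simp
      next
        case False
        have "x' = x2" if "x' \<in> X" "x2 \<sqsubseteq> x'" "x' \<sqsubseteq> b" for x'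
        proof -
          have "x' \<in> I"
            using x2(1) that trans[of a x2 x'] by (simp add: I_def)
          then show ?thesis
            using x2(2) antisym that(2) by blast
        qed
        then show ?thesis
          using False x2 ab by (auto simp: E_def E2_def I_def)
      qed
      ultimately have "(a, b) \<in> (E\<^sup>=) ^^ Suc (Suc h)"
        by (intro relpow_Suc_I2[of a x1] relpow_Suc_I[of x1 x2])
      then show ?thesis by simp
    qed
  qed
  ultimately show ?thesis by blast
qed

text \<open>The outer induction supplies the shortcuts on the cut set \<open>X\<close>, one level
  lower; the inner one treats the components at the same level. The depth of the inner recursion is
  \<open>ack_inv k\<close> of the size, and each round costs linearly many shortcuts.\<close>

lemma shortcut_set_exists:
  assumes "finite A" "A \<subseteq> U"
  shows "\<exists>E. shortcut_set A (2 * Suc k) E \<and> card E \<le> 2 * Suc k * (card A * ack_inv k (card A))"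
  using assms
proof (induction k arbitrary: A)
  case 0
  then show ?case
  proof (induction A rule: finite_psubset_induct)
    case (psubset A)
    show ?case
    proof (cases "card A \<le> 1")
      case True
      then show ?thesis
        using shortcut_set_small[OF psubset.hyps] by (intro exI[of _ "{}"]) simp
    next
      case False
      define N where "N = card A"
      \<comment> \<open>Two cut nodes would need \<open>2 * Suc (N div 2) > N\<close> nodes, so
        \<open>X\<close> has at most one element and needs no shortcuts.\<close>
      define g where "g = N div 2"
      have N: "N \<ge> 2" using False by (simp add: N_def)
      obtain X where *: "X \<subseteq> A" "card X * Suc g \<le> N" "\<forall>r\<in>A. card (below_free A X r) \<le> g"
        using cut_set_exists[OF psubset.hyps psubset.prems, of g] unfolding N_def by auto
      then have X: "X \<subseteq> A" "card X * Suc g \<le> N" "\<And>r. r \<in> A \<Longrightarrow> card (below_free A X r) \<le> g"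
        by simp_all
      have "card X < 2"
      proof (rule ccontr)
        assume "\<not> card X < 2"
        then have "2 * Suc g \<le> card X * Suc g" by (intro mult_right_mono) auto
        then show False using X(2) by (simp add: g_def)
      qed
      then have EG: "shortcut_set X 0 {}"
        using shortcut_set_small finite_subset[OF X(1) psubset.hyps] by simp
      have ack: "Suc (ack_inv 0 g) \<le> ack_inv 0 N"
      proof (cases "ack_inv 0 N")
        case 0
        then show ?thesis using ack_inv_pos[OF N, of 0] by simp
      next
        case (Suc i)
        then have "N \<le> 2 ^ Suc i" using ack_inv_0_le_iff by (metis le_refl)
        then have "g \<le> 2 ^ i" by (simp add: g_def)
        then show ?thesis using Suc by (simp add: ack_inv_0_le_iff)
      qed
      have small: "\<exists>E. shortcut_set D (0 + 2) E \<and> card E \<le> 2 * ack_inv 0 g * card D"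
        if "D \<subseteq> A" "card D \<le> g" for D
      proof -
        have "D \<subset> A" using that N by (auto simp: g_def N_def)
        then obtain E where E: "shortcut_set D 2 E" "card E \<le> 2 * (card D * ack_inv 0 (card D))"
          using psubset.IH[of D] psubset.prems by auto
        have "2 * (card D * ack_inv 0 (card D)) \<le> 2 * (card D * ack_inv 0 g)"
          by (intro mult_left_mono ack_inv_mono that) simp_all
        then have "card E \<le> 2 * ack_inv 0 g * card D"
          using le_trans[OF E(2)] by (simp only: mult_ac)
        then show ?thesis
          unfolding add_0 using E(1) by blast
      qed
      obtain E where E: "shortcut_set A 2 E"
        "card E \<le> 2 * ack_inv 0 g * N + N + card X * g"
        using shortcut_set_step[OF psubset.hyps psubset.prems X(1,3) EG small]
        unfolding N_def add_0 card.empty by blast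
      have "card X * g \<le> N" using X(2) by simp
      then have "card E \<le> 2 * (N * Suc (ack_inv 0 g))"
        using E(2) by (simp add: algebra_simps)
      also have "\<dots> \<le> 2 * (N * ack_inv 0 N)"
        using ack by (intro mult_left_mono) auto
      finally show ?thesis
        using E(1) by (intro exI[of _ E]) (simp add: N_def)
    qed
  qed
next
  case (Suc k)
  note outer = Suc.IH
  show ?case
    using Suc.prems
  proof (induction A rule: finite_psubset_induct)
    case (psubset A)
    show ?case
    proof (cases "card A \<le> 1")
      case True
      then show ?thesis
        using shortcut_set_small[OF psubset.hyps] by (intro exI[of _ "{}"]) simp
    next
      case False
      define N where "N = card A"
      \<comment> \<open>Components of this size lower the value of level \<open>Suc k\<close> by
        exactly one, by \<open>ack_inv_Suc_rec\<close>.\<close>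
      define g where "g = ack_inv k N"
      define K where "K = 2 * Suc (Suc k)"
      have N: "N \<ge> 2" using False by (simp add: N_def)
      obtain X where *: "X \<subseteq> A" "card X * Suc g \<le> N" "\<forall>r\<in>A. card (below_free A X r) \<le> g"
        using cut_set_exists[OF psubset.hyps psubset.prems, of g] unfolding N_def by auto
      then have X: "X \<subseteq> A" "card X * Suc g \<le> N" "\<And>r. r \<in> A \<Longrightarrow> card (below_free A X r) \<le> g"
        by simp_all
      have finX: "finite X" using finite_subset[OF X(1) psubset.hyps] .
      have Xg: "card X * g \<le> N" using X(2) by simp
      obtain EG where EG: "shortcut_set X (2 * Suc k) EG"
        "card EG \<le> 2 * Suc k * (card X * ack_inv k (card X))"
        using outer[OF finX] X(1) psubset.prems by blast
      \<comment> \<open>\<open>X\<close> is smaller than \<open>A\<close> by a factor of about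
        \<open>g\<close>, which cancels the lower-level overhead: its shortcuts are linear in
        \<open>N\<close>.\<close>
      have "card X * ack_inv k (card X) \<le> card X * g"
        unfolding g_def N_def
        by (intro mult_left_mono ack_inv_mono card_mono psubset.hyps X(1)) simp
      then have "card X * ack_inv k (card X) \<le> N" using Xg by linarith
      then have "2 * Suc k * (card X * ack_inv k (card X)) \<le> 2 * Suc k * N"
        by (rule mult_left_mono) simp
      then have cEX: "card EG \<le> 2 * Suc k * N"
        using EG(2) by linarith
      have ack: "ack_inv (Suc k) N = Suc (ack_inv (Suc k) g)"
        unfolding g_def by (rule ack_inv_Suc_rec[OF N])
      have small: "\<exists>E. shortcut_set D (2 * Suc k + 2) E \<and> card E \<le> K * ack_inv (Suc k) g * card D"
        if "D \<subseteq> A" "card D \<le> g" for D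
      proof -
        have "g < N" using N ack_inv_less[of N k] by (simp add: g_def)
        then have "D \<subset> A" using that by (auto simp: N_def)
        then obtain E where E: "shortcut_set D (2 * Suc (Suc k)) E"
          "card E \<le> K * (card D * ack_inv (Suc k) (card D))"
          using psubset.IH[of D] psubset.prems unfolding K_def by blast
        have "K * (card D * ack_inv (Suc k) (card D)) \<le> K * (card D * ack_inv (Suc k) g)"
          by (intro mult_left_mono ack_inv_mono that) simp_all
        then have "card E \<le> K * ack_inv (Suc k) g * card D"
          using le_trans[OF E(2)] by (simp only: mult_ac)
        then show ?thesis
          using E(1) by auto
      qed
      obtain E where E: "shortcut_set A (2 * Suc k + 2) E"
        "card E \<le> card EG + K * ack_inv (Suc k) g * N + N + card X * g"
        using shortcut_set_step[OF psubset.hyps psubset.prems X(1,3) EG(1) small]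
        unfolding N_def by blast
      \<comment> \<open>Apart from the recursive term the cost is
        \<open>2 * Suc k + 1 + 1 = K\<close> times \<open>N\<close>, which is why the same
        \<open>K\<close> serves as coefficient in every round.\<close>
      have "card E \<le> 2 * Suc k * N + K * ack_inv (Suc k) g * N + N + N"
        using E(2) cEX Xg by linarith
      also have "\<dots> = K * (N * ack_inv (Suc k) N)"
        unfolding ack K_def by (simp add: algebra_simps)
      finally show ?thesis
        using E(1) by (intro exI[of _ E]) (simp add: N_def K_def)
    qed
  qed
qed

end

section \<open>Dyadic cells\<close>

text \<open>For \<open>s = 0\<close>, the side of a point object, the cell is a singleton.\<close>
definition cell :: "real \<Rightarrow> real ^ 'd \<Rightarrow> (real ^ 'd) set" where
  "cell s x = {y. y = x \<or> s > 0 \<and> (\<forall>j. \<lfloor>y $ j / s\<rfloor> = \<lfloor>x $ j / s\<rfloor>)}"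

text \<open>Rounding the side length down to a power of two makes the grids of all objects refine
  one another.\<close>

definition dyadic_side :: "(real ^ 'd) set \<Rightarrow> real" where
  "dyadic_side S = (if side_len S > 0 then 2 powr of_int \<lfloor>log 2 (side_len S)\<rfloor> else 0)"

lemma cell_self: "x \<in> cell s x"
  by (simp add: cell_def)

lemma cell_eqI: "y \<in> cell s x \<Longrightarrow> cell s y = cell s x"
  by (auto simp: cell_def)

text \<open>The coarse grid index is the fine one divided by a power of two, rounded down, hence a
  function of it.\<close>

lemma floor_divide_pow2_cong:
  fixes x y :: real
  assumes "\<lfloor>x / 2 powr of_int e\<rfloor> = \<lfloor>y / 2 powr of_int e\<rfloor>" and "e \<le> e'"
  shows "\<lfloor>x / 2 powr of_int e'\<rfloor> = \<lfloor>y / 2 powr of_int e'\<rfloor>"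
proof -
  define m where "m = nat (e' - e)"
  have e': "of_int e' = of_int e + real m"
    using assms(2) by (simp add: m_def)
  have "\<lfloor>z / 2 powr of_int e'\<rfloor> = \<lfloor>z / 2 powr of_int e\<rfloor> div 2 ^ m" for z :: real
  proof -
    have "z / 2 powr of_int e' = z / 2 powr of_int e / of_int (2 ^ m)"
      by (simp add: e' powr_add powr_realpow)
    then show ?thesis
      using floor_divide_real_eq_div[of "2 ^ m" "z / 2 powr of_int e"] by (simp only:) simp
  qed
  then show ?thesis
    using assms(1) by simp
qed

lemma cell_dyadic_side_mono:
  assumes "dyadic_side S \<le> dyadic_side T"
  shows "cell (dyadic_side S) x \<subseteq> cell (dyadic_side T) x"
proof (cases "side_len S > 0")
  case True
  then have "side_len T > 0"
    using assms by (auto simp: dyadic_side_def split: if_splits)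
  define e e' where "e = \<lfloor>log 2 (side_len S)\<rfloor>" and "e' = \<lfloor>log 2 (side_len T)\<rfloor>"
  have s: "dyadic_side S = 2 powr of_int e" "dyadic_side T = 2 powr of_int e'"
    using True \<open>side_len T > 0\<close> by (simp_all add: dyadic_side_def e_def e'_def)
  then have "e \<le> e'"
    using assms by simp
  show ?thesis
  proof
    fix y assume "y \<in> cell (dyadic_side S) x"
    then have "\<lfloor>y $ j / 2 powr of_int e\<rfloor> = \<lfloor>x $ j / 2 powr of_int e\<rfloor>" for j
      unfolding s cell_def by blast
    then have "\<lfloor>y $ j / 2 powr of_int e'\<rfloor> = \<lfloor>x $ j / 2 powr of_int e'\<rfloor>" for j
      using floor_divide_pow2_cong \<open>e \<le> e'\<close> by blast
    then show "y \<in> cell (dyadic_side T) x"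
      unfolding s cell_def by simp
  qed
qed (auto simp: cell_def dyadic_side_def)

text \<open>Laminarity: two cells with a common point \<open>z\<close> are both the cell of
  \<open>z\<close>, in a finer and a coarser grid.\<close>

lemma cell_dyadic_side_nested:
  assumes "dyadic_side S \<le> dyadic_side T"
    and "z \<in> cell (dyadic_side S) x" "z \<in> cell (dyadic_side T) y"
  shows "cell (dyadic_side S) x \<subseteq> cell (dyadic_side T) y"
  using cell_dyadic_side_mono[OF assms(1), of z] assms(2,3)[THEN cell_eqI] by simp

lemma cell_subset_hcube:
  assumes "s \<ge> 0"
  shows "\<exists>a. cell s x \<subseteq> hcube a s"
proof (cases "s = 0")
  case True
  then show ?thesis
    by (intro exI[of _ x]) (auto simp: cell_def hcube_def)
next
  case False
  with assms have "s > 0" by simp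
  have *: "s * of_int \<lfloor>z / s\<rfloor> \<le> z \<and> z \<le> s * of_int \<lfloor>z / s\<rfloor> + s" for z
    using floor_divide_lower[OF \<open>s > 0\<close>, of z] floor_divide_upper[OF \<open>s > 0\<close>, of z]
    by (simp add: algebra_simps)
  have "cell s x \<subseteq> hcube (\<chi> j. s * of_int \<lfloor>x $ j / s\<rfloor>) s"
  proof
    fix y assume "y \<in> cell s x"
    then have "\<lfloor>x $ j / s\<rfloor> = \<lfloor>y $ j / s\<rfloor>" for j
      by (auto simp: cell_def)
    then show "y \<in> hcube (\<chi> j. s * of_int \<lfloor>x $ j / s\<rfloor>) s"
      using *[of "y $ _"] by (simp add: hcube_def)
  qed
  then show ?thesis by blast
qed

section \<open>Side lengths and the number of cells of an object\<close>

lemma component_within_side_len: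
  assumes "bounded S" "x \<in> S"
  shows "(INF x\<in>S. x $ j) \<le> x $ j" "x $ j \<le> (INF x\<in>S. x $ j) + side_len S"
proof -
  have bdd: "bdd_below ((\<lambda>x. x $ j) ` S)" "bdd_above ((\<lambda>x. x $ j) ` S)"
    using bounded_component_cart[OF assms(1), of j]
    by (auto intro: bounded_imp_bdd_below bounded_imp_bdd_above)
  show "(INF x\<in>S. x $ j) \<le> x $ j"
    by (rule cINF_lower[OF bdd(1) assms(2)])
  have "x $ j \<le> (SUP x\<in>S. x $ j)"
    by (rule cSUP_upper[OF assms(2) bdd(2)])
  moreover have "(SUP x\<in>S. x $ j) - (INF x\<in>S. x $ j) \<le> side_len S"
    unfolding side_len_def by (rule Max_ge) auto
  ultimately show "x $ j \<le> (INF x\<in>S. x $ j) + side_len S"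
    by linarith
qed

lemma side_len_nonneg:
  assumes "bounded S" "S \<noteq> {}"
  shows "side_len S \<ge> 0"
proof -
  obtain x where "x \<in> S" using assms(2) by blast
  then show ?thesis
    using component_within_side_len[OF assms(1), of x undefined] by linarith
qed

lemma dyadic_side_nonneg: "dyadic_side S \<ge> 0"
  by (simp add: dyadic_side_def)

lemma dyadic_side_le:
  assumes "side_len S \<ge> 0"
  shows "dyadic_side S \<le> side_len S"
proof (cases "side_len S > 0")
  case True
  have "2 powr of_int \<lfloor>log 2 (side_len S)\<rfloor> \<le> 2 powr log 2 (side_len S)"
    by (intro powr_mono) auto
  then show ?thesis
    using True by (simp add: dyadic_side_def)
qed (use assms in \<open>simp add: dyadic_side_def\<close>)

lemma side_len_less:
  assumes "side_len S > 0"
  shows "side_len S < 2 * dyadic_side S"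
proof -
  have "2 powr log 2 (side_len S) < 2 powr (of_int \<lfloor>log 2 (side_len S)\<rfloor> + 1)"
    by (intro powr_less_mono) linarith+
  then show ?thesis
    using assms by (simp add: dyadic_side_def powr_add)
qed

text \<open>An object extends less than two cell sides along each coordinate, so it meets at most
  three consecutive grid indices there. With side length 0 it is at most a point.\<close>

lemma card_cells:
  fixes S :: "(real ^ 'd) set"
  assumes "bounded S"
  shows "finite (cell (dyadic_side S) ` S)" "card (cell (dyadic_side S) ` S) \<le> 3 ^ CARD('d)"
proof -
  define s where "s = dyadic_side S"
  define lo where "lo j = (INF x\<in>S. x $ j)" for j
  have "finite (cell s ` S) \<and> card (cell s ` S) \<le> 3 ^ CARD('d)"
  proof (cases "side_len S > 0")
    case False
    have "x = y" if "x \<in> S" "y \<in> S" for x y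
    proof -
      have "x $ j = y $ j" for j
        using component_within_side_len[OF assms that(1), of j]
          component_within_side_len[OF assms that(2), of j] False by linarith
      then show ?thesis by (simp add: vec_eq_iff)
    qed
    then have "S = {} \<or> (\<exists>x. S = {x})" by blast
    then show ?thesis by auto
  next
    case True
    define B where "B j = {\<lfloor>lo j / s\<rfloor>..\<lfloor>lo j / s\<rfloor> + 2}" for j :: 'd
    define F where "F f = {y :: real ^ 'd. \<forall>j. \<lfloor>y $ j / s\<rfloor> = f j}" for f
    have s: "s > 0" "side_len S < 2 * s"
      using True side_len_less[OF True] by (auto simp: s_def dyadic_side_def)
    have "cell s x \<in> F ` (PiE UNIV B)" if "x \<in> S" for x
    proof -
      have "\<lfloor>x $ j / s\<rfloor> \<in> B j" for j
      proof -
        have *: "lo j \<le> x $ j" "x $ j \<le> lo j + 2 * s"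
          using component_within_side_len[OF assms that, of j] s by (auto simp: lo_def)
        have "lo j / s \<le> x $ j / s"
          using * s by (simp add: divide_right_mono)
        moreover have "x $ j / s \<le> lo j / s + 2"
          using * s by (simp add: field_simps)
        ultimately have "\<lfloor>lo j / s\<rfloor> \<le> \<lfloor>x $ j / s\<rfloor>" "\<lfloor>x $ j / s\<rfloor> \<le> \<lfloor>lo j / s\<rfloor> + 2"
          by linarith+
        then show ?thesis by (simp add: B_def)
      qed
      moreover have "cell s x = F (\<lambda>j. \<lfloor>x $ j / s\<rfloor>)"
        using s by (auto simp: cell_def F_def)
      ultimately show ?thesis by auto
    qed
    then have sub: "cell s ` S \<subseteq> F ` (PiE UNIV B)" by blast
    have fin: "finite (PiE UNIV B)"
      by (intro finite_PiE) (auto simp: B_def)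
    have "card (PiE UNIV B) = 3 ^ CARD('d)"
      by (simp add: card_PiE B_def)
    then show ?thesis
      using sub fin card_image_le[OF fin, of F] card_mono[of "F ` (PiE UNIV B)" "cell s ` S"]
        finite_subset[OF sub] by auto
  qed
  then show "finite (cell (dyadic_side S) ` S)" "card (cell (dyadic_side S) ` S) \<le> 3 ^ CARD('d)"
    by (simp_all add: s_def)
qed

section \<open>Spanners from shortcuts\<close>

text \<open>Idle steps of the reflexive closure add nothing to the vertex list, so \<open>t\<close>
  steps give at most \<open>t\<close> edges.\<close>

lemma hop_path_relpow:
  assumes "(u, v) \<in> ({(i, j). {i, j} \<in> H}\<^sup>=) ^^ t"
  shows "hop_path H (real t) u v"
  using assms
proof (induction t arbitrary: v)
  case 0
  then show ?case
    by (auto simp: hop_path_def intro!: exI[of _ "[u]"])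
next
  case (Suc t)
  then obtain w where w: "(u, w) \<in> ({(i, j). {i, j} \<in> H}\<^sup>=) ^^ t"
    and wv: "w = v \<or> {w, v} \<in> H"
    by (auto elim!: relpow_Suc_E)
  obtain p where p: "p \<noteq> []" "hd p = u" "last p = w"
    "\<And>m. Suc m < length p \<Longrightarrow> {p ! m, p ! Suc m} \<in> H" "real (length p - 1) \<le> real t"
    using Suc.IH[OF w] by (auto simp: hop_path_def)
  show ?case
  proof (cases "w = v")
    case True
    then show ?thesis
      using p unfolding hop_path_def by (intro exI[of _ p]) auto
  next
    case False
    then have "{w, v} \<in> H" using wv by blast
    have "{(p @ [v]) ! m, (p @ [v]) ! Suc m} \<in> H" if "Suc m < length (p @ [v])" for m
    proof (cases "Suc m < length p")
      case True
      then show ?thesis using p(4)[OF True] by (simp add: nth_append)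
    next
      case False
      then have "length p = Suc m" using that by simp
      then have "(p @ [v]) ! m = w" "(p @ [v]) ! Suc m = v"
        using p(1,3) by (auto simp: nth_append last_conv_nth)
      then show ?thesis using \<open>{w, v} \<in> H\<close> by simp
    qed
    moreover have "real (length (p @ [v]) - 1) \<le> real (Suc t)"
      using p(1,5) by (cases p) auto
    ultimately show ?thesis
      unfolding hop_path_def using p(1,2) by (intro exI[of _ "p @ [v]"]) auto
  qed
qed

lemma sym_relpow: "sym R \<Longrightarrow> (a, b) \<in> R ^^ t \<Longrightarrow> (b, a) \<in> R ^^ t"
proof (induction t arbitrary: b)
  case (Suc t)
  then show ?case
    by (meson relpow_Suc_E relpow_Suc_I2 symD)
qed simp

text \<open>Both sides are 3 for \<open>k = 0\<close>; then the left grows by 4 while a right side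
  \<open>t\<close> becomes \<open>3 * t + 4/3\<close>.\<close>

lemma hop_count_le: "real (4 * Suc k - 1) \<le> (11/9) * 3 ^ Suc k - 2/3"
proof (induction k)
  case (Suc k)
  then show ?case by simp
qed simp


text \<open>Comparing indices breaks ties between objects that share a cell.\<close>
definition piece_le :: "(nat \<Rightarrow> (real ^ 'd) set) \<Rightarrow> nat \<times> (real ^ 'd) set \<Rightarrow> nat \<times> (real ^ 'd) set \<Rightarrow> bool" where
  "piece_le Obj a b \<longleftrightarrow>
     (dyadic_side (Obj (fst a)) < dyadic_side (Obj (fst b)) \<or>
      dyadic_side (Obj (fst a)) = dyadic_side (Obj (fst b)) \<and> fst a \<le> fst b) \<and>
     snd a \<subseteq> snd b"

text \<open>A piece stores its whole cell, not the intersection with the object; the index keeps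
  objects in the same cell apart.\<close>

definition pieces :: "nat \<Rightarrow> (nat \<Rightarrow> (real ^ 'd) set) \<Rightarrow> (nat \<times> (real ^ 'd) set) set" where
  "pieces n Obj = (SIGMA i:{..<n}. cell (dyadic_side (Obj i)) ` Obj i)"

text \<open>By laminarity the finer of two cells sharing a point lies in the coarser; for equal
  sides the cells coincide and the index decides.\<close>

lemma piece_le_total:
  assumes "a \<in> pieces n Obj" "b \<in> pieces n Obj" "x \<in> snd a" "x \<in> snd b"
  shows "piece_le Obj a b \<or> piece_le Obj b a"
proof -
  obtain i y where a: "a = (i, cell (dyadic_side (Obj i)) y)"
    using assms(1) by (auto simp: pieces_def)
  obtain j z where b: "b = (j, cell (dyadic_side (Obj j)) z)"
    using assms(2) by (auto simp: pieces_def)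
  have sub: "dyadic_side (Obj i) \<le> dyadic_side (Obj j) \<Longrightarrow> snd a \<subseteq> snd b"
    "dyadic_side (Obj j) \<le> dyadic_side (Obj i) \<Longrightarrow> snd b \<subseteq> snd a"
    using assms(3,4) cell_dyadic_side_nested[of "Obj i" "Obj j" x y z]
      cell_dyadic_side_nested[of "Obj j" "Obj i" x z y] unfolding a b snd_conv by blast+
  have "fst a = i" "fst b = j"
    by (simp_all add: a b)
  then show ?thesis
    using sub unfolding piece_le_def
    by (cases "dyadic_side (Obj i)" "dyadic_side (Obj j)" rule: linorder_cases; cases "i \<le> j") auto
qed

text \<open>A point of the cell of \<open>a\<close> lies in every cell above it, so any two pieces
  above \<open>a\<close> share a point.\<close>

lemma forest_order_piece_le: "forest_order (piece_le Obj) (pieces n Obj)"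
proof
  show "piece_le Obj b c \<or> piece_le Obj c b"
    if abc: "a \<in> pieces n Obj" "b \<in> pieces n Obj" "c \<in> pieces n Obj" "piece_le Obj a b" "piece_le Obj a c"
    for a b c
  proof -
    obtain i y where "a = (i, cell (dyadic_side (Obj i)) y)"
      using abc(1) by (auto simp: pieces_def)
    then have "y \<in> snd b" "y \<in> snd c"
      using abc(4,5) cell_self[of y] by (auto simp: piece_le_def)
    then show ?thesis
      using piece_le_total abc(2,3) by blast
  qed
qed (auto simp: piece_le_def prod_eq_iff)

section \<open>The number of pieces and their hitting points\<close>

lemma card_pieces:
  fixes Obj :: "nat \<Rightarrow> (real ^ 'd) set"
  assumes "\<And>i. i < n \<Longrightarrow> bounded (Obj i)"
  shows "finite (pieces n Obj)" "card (pieces n Obj) \<le> 3 ^ CARD('d) * n"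
proof -
  show "finite (pieces n Obj)"
    unfolding pieces_def using card_cells(1) assms by blast
  have "card (pieces n Obj) = (\<Sum>i<n. card (cell (dyadic_side (Obj i)) ` Obj i))"
    unfolding pieces_def using card_cells(1) assms by (subst card_SigmaI) auto
  also have "\<dots> \<le> of_nat (card {..<n}) * 3 ^ CARD('d)"
    by (rule sum_bounded_above) (use card_cells(2) assms in auto)
  finally show "card (pieces n Obj) \<le> 3 ^ CARD('d) * n"
    by (simp add: mult.commute)
qed

text \<open>The cell of \<open>y\<close> fits into a hypercube with its own side \<open>s\<close>,
  and objects of pieces above \<open>y\<close> have side length at least \<open>s\<close>, so one
  set of \<open>c\<close> points serves all of them. The points need not lie in the cell.\<close>

lemma c_fat_pieces:
  assumes "c_fat c n Obj" "\<And>i. i < n \<Longrightarrow> bounded (Obj i)" "y \<in> pieces n Obj"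
  shows "\<exists>P. finite P \<and> card P \<le> c \<and>
    (\<forall>b\<in>pieces n Obj. piece_le Obj y b \<and> Obj (fst b) \<inter> snd y \<noteq> {} \<longrightarrow> P \<inter> Obj (fst b) \<noteq> {})"
proof -
  define s where "s = dyadic_side (Obj (fst y))"
  obtain x where "snd y = cell s x"
    using assms(3) by (auto simp: pieces_def s_def)
  then obtain a where a: "snd y \<subseteq> hcube a s"
    using cell_subset_hcube[of s x] by (auto simp: s_def dyadic_side_nonneg)
  have "s \<ge> 0" by (simp add: s_def dyadic_side_nonneg)
  then obtain P where P: "finite P" "card P \<le> c"
    "\<forall>i<n. Obj i \<inter> hcube a s \<noteq> {} \<and> side_len (Obj i) \<ge> s \<longrightarrow> P \<inter> Obj i \<noteq> {}"
    using assms(1)[unfolded c_fat_def, THEN spec[of _ a], THEN spec[of _ s], THEN mp, OF \<open>s \<ge> 0\<close>]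
    by blast
  have "P \<inter> Obj (fst b) \<noteq> {}"
    if "b \<in> pieces n Obj" "piece_le Obj y b" "Obj (fst b) \<inter> snd y \<noteq> {}" for b
  proof -
    have "fst b < n" using that(1) by (auto simp: pieces_def)
    moreover have "Obj (fst b) \<noteq> {}" using that(3) by blast
    ultimately have "dyadic_side (Obj (fst b)) \<le> side_len (Obj (fst b))"
      using dyadic_side_le side_len_nonneg assms(2) by blast
    moreover have "s \<le> dyadic_side (Obj (fst b))"
      using that(2) by (auto simp: piece_le_def s_def)
    moreover have "Obj (fst b) \<inter> hcube a s \<noteq> {}"
      using that(3) a by blast
    ultimately show ?thesis
      using P(3) \<open>fst b < n\<close> by force
  qed
  then show ?thesis
    using P(1,2) by blast
qed

text \<open>Of the \<open>m + 2\<close> shortcuts on a path, the first costs 2 hops, each of the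
  \<open>m\<close> middle ones 2, and the last 1. Each shortcut or idle step contributes at most
  \<open>5 * c\<^sup>2\<close> edges.\<close>

lemma spanner_of_shortcuts:
  fixes Obj :: "nat \<Rightarrow> (real ^ 'd) set"
  assumes bdd: "\<And>i. i < n \<Longrightarrow> bounded (Obj i)" and fat: "c_fat c n Obj" and "c \<ge> 1"
    and E: "forest_order.shortcut_set (piece_le Obj) (pieces n Obj) (Suc (Suc m)) E"
  shows "\<exists>H. hop_spanner n Obj H (real (2 * m + 3)) \<and>
           card H \<le> 5 * c\<^sup>2 * (card E + card (pieces n Obj))"
proof -
  interpret forest_order "piece_le Obj" "pieces n Obj"
    by (rule forest_order_piece_le)
  define A where "A = pieces n Obj"
  define ob :: "nat \<times> (real ^ 'd) set \<Rightarrow> nat" where "ob = fst"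
  have finA: "finite A"
    using card_pieces(1)[OF bdd] by (simp add: A_def)
  have ob_less: "ob a < n" if "a \<in> A" for a
    using that by (auto simp: A_def pieces_def ob_def)
  have E_sub: "E \<subseteq> {(a, b) \<in> A \<times> A. piece_le Obj a b}"
    and E_path: "\<And>a b. a \<in> A \<Longrightarrow> b \<in> A \<Longrightarrow> piece_le Obj a b \<Longrightarrow> (a, b) \<in> (E\<^sup>=) ^^ Suc (Suc m)"
    using E by (auto simp: shortcut_set_def A_def)
  have "\<forall>y\<in>A. \<exists>P. finite P \<and> card P \<le> c \<and>
    (\<forall>b\<in>A. piece_le Obj y b \<and> Obj (ob b) \<inter> snd y \<noteq> {} \<longrightarrow> P \<inter> Obj (ob b) \<noteq> {})"
    using c_fat_pieces[OF fat bdd] by (simp add: A_def ob_def)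
  then obtain P where P: "\<forall>y\<in>A. finite (P y) \<and> card (P y) \<le> c \<and>
    (\<forall>b\<in>A. piece_le Obj y b \<and> Obj (ob b) \<inter> snd y \<noteq> {} \<longrightarrow> P y \<inter> Obj (ob b) \<noteq> {})"
    by (rule bchoice[THEN exE])
  \<comment> \<open>\<open>r q\<close> is the centre of \<open>q\<close>. None of the three choices
    depends on the far endpoint of the edge to be spanned; that endpoint only witnesses that a
    choice exists, so edges are counted per point and not per pair of objects.\<close>
  define r where "r q = (SOME i. i < n \<and> q \<in> Obj i)" for q
  define w where "w u q = (SOME i. i < n \<and> q \<in> Obj i \<and> Obj u \<inter> Obj i \<noteq> {})" for u q
  define o2 where "o2 q q' = (SOME i. i < n \<and> q \<in> Obj i \<and> q' \<in> Obj i)" for q q'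
  have r: "r q < n \<and> q \<in> Obj (r q)" if "i < n" "q \<in> Obj i" for i q
    unfolding r_def by (rule someI[of _ i]) (use that in auto)
  have w: "w u q < n \<and> q \<in> Obj (w u q) \<and> Obj u \<inter> Obj (w u q) \<noteq> {}"
    if "i < n" "q \<in> Obj i" "Obj u \<inter> Obj i \<noteq> {}" for i u q
    unfolding w_def by (rule someI[of _ i]) (use that in auto)
  have o2: "o2 q q' < n \<and> q \<in> Obj (o2 q q') \<and> q' \<in> Obj (o2 q q')"
    if "i < n" "q \<in> Obj i" "q' \<in> Obj i" for i q q'
    unfolding o2_def by (rule someI[of _ i]) (use that in auto)
  \<comment> \<open>The families serve \<open>(a, b)\<close> as first shortcut (two), middle
    shortcut (two) and last shortcut (one); its position on a path is not known in advance.\<close>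
  define L where "L = (\<lambda>(a, b).
      (\<lambda>q. {ob a, w (ob a) q}) ` P b \<union> (\<lambda>q. {w (ob a) q, r q}) ` P b \<union>
      (\<lambda>(q, q'). {r q, o2 q q'}) ` (P a \<times> P b) \<union> (\<lambda>(q, q'). {o2 q q', r q'}) ` (P a \<times> P b) \<union>
      (\<lambda>q. {r q, ob b}) ` P a)"
  \<comment> \<open>Idle steps of a walk in the reflexive closure also need edges, hence the
    diagonal, which adds \<open>card A\<close> to the count.\<close>
  define E' where "E' = E \<union> Id_on A"
  \<comment> \<open>Intersecting discards loops and edges from \<open>SOME\<close> without a
    witness, for example at a point that lies in no object.\<close>
  define H where "H = (\<Union>e\<in>E'. L e) \<inter> isect_edges n Obj"
  define R where "R = {(i, j). {i, j} \<in> H}\<^sup>="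
  have finE: "finite E"
    by (rule finite_subset[OF E_sub]) (use finA in \<open>auto intro: finite_subset[of _ "A \<times> A"]\<close>)
  have finE': "finite E'"
    using finE finA by (simp add: E'_def Id_on_def)
  have E'_sub: "E' \<subseteq> A \<times> A"
    using E_sub by (auto simp: E'_def)
  have finL: "finite (L e)" and cardL: "card (L e) \<le> 5 * c\<^sup>2" if e_in: "e \<in> E'" for e
  proof -
    obtain a b where e: "e = (a, b)" "a \<in> A" "b \<in> A"
      using e_in E'_sub by blast
    then have fin: "finite (P a)" "finite (P b)" and le: "card (P a) \<le> c" "card (P b) \<le> c"
      using P by auto
    show "finite (L e)"
      using fin by (simp add: L_def e)
    have cc: "card (P a \<times> P b) \<le> c\<^sup>2"
      using le by (simp add: card_cartesian_product power2_eq_square mult_mono)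
    have c: "c \<le> c\<^sup>2"
      using \<open>c \<ge> 1\<close> by (simp add: power2_eq_square)
    have im: "card (f ` P a) \<le> c\<^sup>2" "card (f ` P b) \<le> c\<^sup>2" "card (h ` (P a \<times> P b)) \<le> c\<^sup>2"
      for f :: "real ^ 'd \<Rightarrow> nat set" and h :: "(real ^ 'd) \<times> (real ^ 'd) \<Rightarrow> nat set"
      using card_image_le[OF fin(1), of f] card_image_le[OF fin(2), of f]
        card_image_le[of "P a \<times> P b" h] fin le c cc by auto
    have un: "card (S \<union> T) \<le> (k + 1) * c\<^sup>2" if "card S \<le> k * c\<^sup>2" "card T \<le> c\<^sup>2"
      for S T :: "nat set set" and k
      using card_Un_le[of S T] that by simp
    have "card (L e) \<le> (1 + 1 + 1 + 1 + 1) * c\<^sup>2"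
      unfolding L_def e prod.case by (intro un im) (simp add: im)
    then show "card (L e) \<le> 5 * c\<^sup>2" by simp
  qed
  have "card H \<le> card (\<Union>e\<in>E'. L e)"
    unfolding H_def using finE' finL by (intro card_mono) auto
  also have "\<dots> \<le> (\<Sum>e\<in>E'. card (L e))"
    by (rule card_UN_le[OF finE'])
  also have "\<dots> \<le> of_nat (card E') * (5 * c\<^sup>2)"
    by (rule sum_bounded_above[OF cardL])
  also have "\<dots> \<le> 5 * c\<^sup>2 * (card E + card A)"
  proof -
    have "card (Id_on A) \<le> card A"
      unfolding Id_on_def using card_UN_le[OF finA, of "\<lambda>x. {(x, x)}"] by simp
    then have "card E' \<le> card E + card A"
      unfolding E'_def using card_Un_le[of E "Id_on A"] by linarith
    then show ?thesis by (simp add: mult.commute)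
  qed
  finally have cardH: "card H \<le> 5 * c\<^sup>2 * (card E + card (pieces n Obj))"
    by (simp add: A_def)
  have "sym R"
    by (auto simp: R_def sym_def insert_commute)
  have RI: "(i, j) \<in> R"
    if "{i, j} \<in> L e" "e \<in> E'" "i < n" "j < n" "Obj i \<inter> Obj j \<noteq> {}" for i j e
  proof (cases "i = j")
    case False
    then have "{i, j} \<in> isect_edges n Obj"
      unfolding isect_edges_def using that(3-5) by blast
    then show ?thesis
      using that(1,2) by (auto simp: R_def H_def)
  qed (simp add: R_def)
  have E'I: "(a, b) \<in> E' \<and> b \<in> A \<and> piece_le Obj a b" if "(a, b) \<in> E\<^sup>=" "a \<in> A" for a b
    using that E_sub refl[of b] by (auto simp: E'_def)
  have hop_start: "\<exists>q\<in>P y \<inter> Obj (ob b). (ob a, r q) \<in> R ^^ 2"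
    if a: "(a, y) \<in> E\<^sup>=" "a \<in> A" "b \<in> A" "piece_le Obj y b"
      "x \<in> snd a" "x \<in> Obj (ob a)" "x \<in> Obj (ob b)" for a y b x
  proof -
    have ay: "(a, y) \<in> E'" "y \<in> A" "piece_le Obj a y"
      using E'I[OF a(1,2)] by blast+
    then have "x \<in> snd y" using a(5) by (auto simp: piece_le_def)
    \<comment> \<open>The common point \<open>x\<close> shows that the object of \<open>b\<close>
      meets the cell of \<open>y\<close>, so fatness puts a point of \<open>P y\<close> into
      it.\<close>
    then obtain q where q: "q \<in> P y" "q \<in> Obj (ob b)"
      using P ay(2) a(3,4,7) by blast
    have W: "w (ob a) q < n" "q \<in> Obj (w (ob a) q)" "Obj (ob a) \<inter> Obj (w (ob a) q) \<noteq> {}"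
      using w[OF ob_less[OF a(3)] q(2), of "ob a"] a(6,7) by auto
    have rq: "r q < n" "q \<in> Obj (r q)"
      using r[OF ob_less[OF a(3)] q(2)] by auto
    have "(ob a, w (ob a) q) \<in> R"
      by (rule RI[OF _ ay(1)]) (use q W ob_less[OF a(2)] in \<open>auto simp: L_def\<close>)
    moreover have "(w (ob a) q, r q) \<in> R"
      by (rule RI[OF _ ay(1)]) (use q W rq in \<open>auto simp: L_def\<close>)
    ultimately have "(ob a, r q) \<in> R ^^ 2"
      by (auto simp: numeral_2_eq_2)
    then show ?thesis using q by blast
  qed
  have path_le: "y' \<in> A \<and> piece_le Obj y y'" if "(y, y') \<in> (E\<^sup>=) ^^ l" "y \<in> A" for y y' l
    using that(1)
  proof (induction l arbitrary: y')
    case (Suc l)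
    then obtain z where "(y, z) \<in> (E\<^sup>=) ^^ l" "(z, y') \<in> E\<^sup>="
      by (blast elim: relpow_Suc_E)
    then show ?case
      using Suc.IH[of z] E'I[of z y'] trans[of y z y'] by blast
  qed (use that(2) refl in simp)
  \<comment> \<open>Invariant along the walk: the centre reached belongs to a point inside the
    object of \<open>b\<close>. That object contains the old and the new point and so witnesses the
    choice of \<open>o2\<close>.\<close>
  have hop_middle: "\<exists>q'\<in>P y' \<inter> Obj (ob b). (r q, r q') \<in> R ^^ (2 * l)"
    if "(y, y') \<in> (E\<^sup>=) ^^ l" "y \<in> A" "b \<in> A" "piece_le Obj y' b"
      "x \<in> snd y" "x \<in> Obj (ob b)" "q \<in> P y \<inter> Obj (ob b)"
    for y y' b x q l
    using that(1,4)
  proof (induction l arbitrary: y')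
    case 0
    then show ?case
      using that(7) by auto
  next
    case (Suc l)
    then obtain z where z: "(y, z) \<in> (E\<^sup>=) ^^ l" "(z, y') \<in> E\<^sup>="
      by (blast elim: relpow_Suc_E)
    have "z \<in> A"
      using path_le[OF z(1) \<open>y \<in> A\<close>] by blast
    then have zy': "(z, y') \<in> E'" "y' \<in> A" "piece_le Obj z y'"
      using E'I[OF z(2)] by blast+
    obtain q1 where q1: "q1 \<in> P z" "q1 \<in> Obj (ob b)" "(r q, r q1) \<in> R ^^ (2 * l)"
      using Suc.IH[OF z(1)] trans[OF zy'(3) Suc.prems(2)] by blast
    have "x \<in> snd y'"
      using path_le[OF Suc.prems(1) \<open>y \<in> A\<close>] \<open>x \<in> snd y\<close> by (auto simp: piece_le_def)
    then obtain q2 where q2: "q2 \<in> P y'" "q2 \<in> Obj (ob b)"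
      using P zy'(2) Suc.prems(2) \<open>b \<in> A\<close> \<open>x \<in> Obj (ob b)\<close> by blast
    have b: "ob b < n" using ob_less \<open>b \<in> A\<close> by blast
    note objs = o2[OF b q1(2) q2(2)] r[OF b q1(2)] r[OF b q2(2)]
    have "{r q1, o2 q1 q2} \<in> L (z, y')" "{o2 q1 q2, r q2} \<in> L (z, y')"
      using q1 q2 by (force simp: L_def)+
    then have "(r q1, o2 q1 q2) \<in> R" "(o2 q1 q2, r q2) \<in> R"
      using objs by (auto intro!: RI[OF _ zy'(1)])
    then have "(r q, r q2) \<in> R ^^ Suc (Suc (2 * l))"
      using q1(3) by (meson relpow_Suc_I)
    then show ?case using q2 by auto
  qed
  have hop_end: "(r q, ob b) \<in> R"
    if "(y, b) \<in> E\<^sup>=" "y \<in> A" "q \<in> P y \<inter> Obj (ob b)" for y b q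
  proof -
    have yb: "(y, b) \<in> E'" "b \<in> A"
      using E'I[OF that(1,2)] by blast+
    show ?thesis
      by (rule RI[OF _ yb(1)])
        (use that(3) r[OF ob_less[OF yb(2)]] ob_less[OF yb(2)] in \<open>auto simp: L_def\<close>)
  qed
  have hop: "(ob a, ob b) \<in> R ^^ (2 * m + 3)"
    if a: "a \<in> A" "b \<in> A" "piece_le Obj a b" "x \<in> snd a" "x \<in> Obj (ob a)" "x \<in> Obj (ob b)" for a b x
  proof -
    obtain y where y: "(a, y) \<in> E\<^sup>=" "(y, b) \<in> (E\<^sup>=) ^^ Suc m"
      using E_path[OF a(1-3)] by (blast dest: relpow_Suc_D2)
    then obtain z where z: "(y, z) \<in> (E\<^sup>=) ^^ m" "(z, b) \<in> E\<^sup>="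
      by (blast elim: relpow_Suc_E)
    have ay: "y \<in> A" "piece_le Obj a y"
      using E'I[OF y(1) a(1)] by blast+
    have yz: "z \<in> A" "piece_le Obj y z"
      using path_le[OF z(1) ay(1)] by blast+
    have zb: "piece_le Obj z b"
      using E'I[OF z(2) yz(1)] by blast
    have xy: "x \<in> snd y" using ay(2) a(4) by (auto simp: piece_le_def)
    obtain q where q: "q \<in> P y \<inter> Obj (ob b)" "(ob a, r q) \<in> R ^^ 2"
      using hop_start[OF y(1) a(1,2) trans[OF yz(2) zb] a(4-6)] by blast
    obtain q' where q': "q' \<in> P z \<inter> Obj (ob b)" "(r q, r q') \<in> R ^^ (2 * m)"
      using hop_middle[OF z(1) ay(1) a(2) zb xy a(6) q(1)] by blast
    have "(ob a, r q') \<in> R ^^ (2 + 2 * m)"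
      unfolding relpow_add using q(2) q'(2) by blast
    then have "(ob a, ob b) \<in> R ^^ Suc (2 + 2 * m)"
      using hop_end[OF z(2) yz(1) q'(1)] by (rule relpow_Suc_I)
    then show ?thesis by (simp add: numeral_3_eq_3)
  qed
  have "hop_spanner n Obj H (real (2 * m + 3))"
    unfolding hop_spanner_def
  proof (intro conjI allI impI)
    show "H \<subseteq> isect_edges n Obj" by (simp add: H_def)
  next
    fix u v assume "{u, v} \<in> isect_edges n Obj"
    then have uv: "u < n" "v < n" "Obj u \<inter> Obj v \<noteq> {}"
      by (auto simp: isect_edges_def doubleton_eq_iff)
    then obtain x where x: "x \<in> Obj u" "x \<in> Obj v" by blast
    define a where "a = (u, cell (dyadic_side (Obj u)) x)"
    define b where "b = (v, cell (dyadic_side (Obj v)) x)"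
    have ab: "a \<in> A" "b \<in> A" "x \<in> snd a" "x \<in> snd b" "ob a = u" "ob b = v"
      using uv x by (auto simp: a_def b_def A_def pieces_def ob_def cell_self)
    then consider "piece_le Obj a b" | "piece_le Obj b a"
      using piece_le_total by (metis A_def)
    then have "(u, v) \<in> R ^^ (2 * m + 3)"
    proof cases
      case 1
      then show ?thesis using hop[OF ab(1,2) 1 ab(3)] x ab by simp
    next
      case 2
      have "(v, u) \<in> R ^^ (2 * m + 3)"
        using hop[OF ab(2,1) 2 ab(4)] x ab by simp
      then show ?thesis using sym_relpow[OF \<open>sym R\<close>] by blast
    qed
    then show "hop_path H (real (2 * m + 3)) u v"
      unfolding R_def by (rule hop_path_relpow)
  qed
  then show ?thesis using cardH by blast
qed

theorem theorem15:
  fixes c k :: nat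
  assumes "c \<ge> 1" and "k \<ge> 1"
  shows "\<exists>C::real. \<forall>(n::nat) (Obj :: nat \<Rightarrow> (real ^ 'd) set).
           (\<forall>i<n. bounded (Obj i)) \<and> c_fat c n Obj \<longrightarrow>
           (\<exists>H. hop_spanner n Obj H ((11/9) * 3 ^ k - 2/3) \<and>
                real (card H) \<le> C * real n * inv_ack k (real n))"
proof -
  obtain k' where k: "k = Suc k'"
    using assms(2) by (cases k) auto
  \<comment> \<open>\<open>D\<close> bounds the pieces per object. In \<open>C\<close>, the factor
    \<open>1 + D\<close> absorbs the additive shift of \<open>ack_inv\<close> between pieces and
    objects, and \<open>Suc K\<close> covers shortcuts and pieces together.\<close>
  define D where "D = (3 ^ CARD('d) :: nat)"
  define K where "K = 2 * Suc k'"
  define C where "C = 5 * c\<^sup>2 * (Suc K * (D * (1 + D)))"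
  have main: "\<exists>H. hop_spanner n Obj H ((11/9) * 3 ^ k - 2/3) \<and>
                real (card H) \<le> real C * real n * inv_ack k (real n)"
    if bdd: "\<And>i. i < n \<Longrightarrow> bounded (Obj i)" and fat: "c_fat c n Obj"
    for n and Obj :: "nat \<Rightarrow> (real ^ 'd) set"
  proof (cases "n \<ge> 2")
    case False
    then have "isect_edges n Obj = {}"
      by (auto simp: isect_edges_def)
    then show ?thesis
      by (intro exI[of _ "{}"]) (simp add: hop_spanner_def k inv_ack_Suc_of_nat del: inv_ack.simps)
  next
    case True
    interpret forest_order "piece_le Obj" "pieces n Obj"
      by (rule forest_order_piece_le)
    define M where "M = card (pieces n Obj)"
    have M: "M \<le> D * n"
      using card_pieces(2)[OF bdd] by (simp add: M_def D_def)
    obtain E where E: "shortcut_set (pieces n Obj) (2 * Suc k') E" "card E \<le> K * (M * ack_inv k' M)"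
      using shortcut_set_exists[OF card_pieces(1)[OF bdd] subset_refl] unfolding M_def K_def by blast
    have "shortcut_set (pieces n Obj) (Suc (Suc (2 * k'))) E"
      using E(1) by simp
    then obtain H where H: "hop_spanner n Obj H (real (2 * (2 * k') + 3))"
      "card H \<le> 5 * c\<^sup>2 * (card E + M)"
      using spanner_of_shortcuts[OF bdd fat assms(1)] unfolding M_def by blast
    have pos: "1 \<le> ack_inv k' n"
      by (rule ack_inv_pos[OF True])
    \<comment> \<open>The crude bound \<open>D \<le> 2 ^ D\<close> allows \<open>D\<close>
      doublings; \<open>pos\<close> then makes the additive \<open>D\<close> a multiplicative
      \<open>1 + D\<close>.\<close>
    have "M \<le> 2 ^ D * n"
      using M by (rule le_trans) (simp add: less_imp_le)
    then have "ack_inv k' M \<le> ack_inv k' n + D"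
      using ack_inv_mono ack_inv_pow2_mult le_trans by blast
    also have "\<dots> \<le> (1 + D) * ack_inv k' n"
      using pos by (simp add: algebra_simps)
    finally have ack: "ack_inv k' M \<le> (1 + D) * ack_inv k' n" .
    have "M * ack_inv k' M \<le> (D * n) * ((1 + D) * ack_inv k' n)"
      by (intro mult_mono M ack) simp_all
    moreover have "M \<le> (D * n) * ((1 + D) * ack_inv k' n)"
      using mult_mono[OF M, of 1 "(1 + D) * ack_inv k' n"] pos by simp
    ultimately have "card E + M \<le> K * ((D * n) * ((1 + D) * ack_inv k' n)) + (D * n) * ((1 + D) * ack_inv k' n)"
      using E(2) mult_left_mono[of "M * ack_inv k' M" _ K] by (meson add_mono le_trans le0)
    also have "\<dots> = Suc K * (D * (1 + D)) * (n * ack_inv k' n)"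
      by (simp add: algebra_simps)
    finally have "5 * c\<^sup>2 * (card E + M) \<le> 5 * c\<^sup>2 * (Suc K * (D * (1 + D)) * (n * ack_inv k' n))"
      by (rule mult_left_mono) simp
    also have "\<dots> = C * n * ack_inv k' n"
      by (simp only: C_def mult_ac)
    finally have "card H \<le> C * n * ack_inv k' n"
      using H(2) by linarith
    then have "real (card H) \<le> real C * real n * inv_ack k (real n)"
      unfolding k inv_ack_Suc_of_nat of_nat_mult[symmetric] of_nat_le_iff .
    \<comment> \<open>With \<open>m = 2 * k'\<close> the hop count \<open>2 * m + 3\<close> equals
      \<open>4 * Suc k' - 1\<close>.\<close>
    moreover have "real (2 * (2 * k') + 3) \<le> (11/9) * 3 ^ k - 2/3"
      using hop_count_le[of k'] by (simp add: k)
    then have "hop_spanner n Obj H ((11/9) * 3 ^ k - 2/3)"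
      using H(1) unfolding hop_spanner_def hop_path_def by (meson order_trans)
    ultimately show ?thesis by blast
  qed
  show ?thesis
    by (intro exI[of _ "real C"] allI impI main) auto
qed

end
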